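(* Let $k$ be a fixed positive integer, and let $f_1, f_2, f_3, \dots$ be a sequence of functions where $f_i : \{1,\dots,i\} \to \{1,\dots,i\}$ is a $k$-max function for each $i$. For each $n$, let $D(f_n)$ denote the number of $f_n$-derangements. Then $$\lim_{n\to\infty} \frac{D(f_n)}{n!} = \frac{1}{e}.$$
   Context: For a function $f:\{1,\dots,n\}\to\{1,\dots,n\}$ (not necessarily one-to-one), an $f$-derangement is a permutation $g$ of $\{1,\dots,n\}$ such that $g(i)\neq f(i)$ for every $i=1,\dots,n$. A function $f$ is called a $k$-max function if every value has at most $k$ preimages under $f$, i.e. $|f^{-1}(y)|\le k$ for every $y$. *)

theory Defs
  imports Complex_Main "HOL-Combinatorics.Permutations" "HOL-Library.FuncSet"
begin

(* A function {1..n} -> {1..n} is a total function nat => nat of which only the values on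
   {1..n} matter.  A permutation g satisfies "g permutes {1..n}", so it is the identity outside
   {1..n}; hence each permutation of {1..n} is represented, and counted, exactly once. *)

definition f_derangement :: "nat \<Rightarrow> (nat \<Rightarrow> nat) \<Rightarrow> (nat \<Rightarrow> nat) \<Rightarrow> bool" where
  "f_derangement n f g \<longleftrightarrow> g permutes {1..n} \<and> (\<forall>i\<in>{1..n}. g i \<noteq> f i)"

definition num_f_derangements :: "nat \<Rightarrow> (nat \<Rightarrow> nat) \<Rightarrow> nat" where
  "num_f_derangements n f = card {g. f_derangement n f g}"

definition k_max :: "nat \<Rightarrow> nat \<Rightarrow> (nat \<Rightarrow> nat) \<Rightarrow> bool" where
  "k_max k n f \<longleftrightarrow> (\<forall>y\<in>{1..n}. card (f -` {y} \<inter> {1..n}) \<le> k)"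

end

theory Submission
  imports Defs "HOL-Analysis.Uniform_Limit" "HOL-Real_Asymp.Real_Asymp"
begin

text \<open>
  Inclusion-exclusion gives \<open>D(f) = (\<Sum>j\<le>n. (-1)^j N\<^sub>j (n - j)!)\<close>, where \<open>N\<^sub>j\<close> counts the
  \<open>j\<close>-element sets on which \<open>f\<close> is injective: only on such sets can a permutation agree with \<open>f\<close>.
  Trivially \<open>N\<^sub>j \<le> n choose j\<close>.  Conversely, such a set can be enlarged by any point
  outside the at most \<open>j k\<close> points that share a value with it, so
  \<open>(j + 1) N\<^sub>j\<^sub>+\<^sub>1 \<ge> (n - j k) N\<^sub>j\<close>.  Hence \<open>N\<^sub>j (n - j)! / n!\<close> is at most \<open>1 / j!\<close> and
  tends to \<open>1 / j!\<close>, and Tannery's theorem yields the limit \<open>(\<Sum>j. (-1)^j / j!) = 1 / e\<close>.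
\<close>

text \<open>Injectivity lets \<open>f\<close> on \<open>S\<close> extend to one permutation
  \<open>h\<close> of \<open>A\<close>; composing with \<open>h\<close> then carries the
  permutations fixing \<open>S\<close> pointwise to those agreeing with \<open>f\<close> on
  \<open>S\<close>.\<close>

lemma card_permutes_extending:
  assumes "finite A" "S \<subseteq> A" "inj_on f S" "f ` S \<subseteq> A"
  shows "card {g. g permutes A \<and> (\<forall>i\<in>S. g i = f i)} = fact (card A - card S)"
proof -
  have fin: "finite S" using assms finite_subset by blast
  have "card (A - S) = card (A - f ` S)"
    using assms(2,4) fin by (simp add: card_Diff_subset card_image[OF assms(3)])
  \<comment> \<open>Any bijection between the complements will do: it completes \<open>f\<close> on
    \<open>S\<close> to a bijection of \<open>A\<close>.\<close>
  then obtain e where e: "bij_betw e (A - S) (A - f ` S)"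
    using assms(1) finite_same_card_bij[of "A - S" "A - f ` S"] by auto
  have "bij_betw (\<lambda>x. if x \<in> S then f x else e x) (S \<union> (A - S)) (f ` S \<union> (A - f ` S))"
    using assms(3) e by (intro bij_betw_disjoint_Un) (auto simp: bij_betw_def)
  moreover have "S \<union> (A - S) = A" "f ` S \<union> (A - f ` S) = A" using assms by auto
  ultimately have b: "bij_betw (\<lambda>x. if x \<in> S then f x else e x) A A" by simp
  define h where "h x = (if x \<in> A then if x \<in> S then f x else e x else x)" for x
  have "bij_betw h A A"
    using b by (rule bij_betw_cong[THEN iffD1, rotated]) (simp add: h_def)
  then have h: "h permutes A"
    by (rule bij_imp_permutes) (simp add: h_def)
  have hS: "h i = f i" if "i \<in> S" for i using that assms(2) by (auto simp: h_def)
  have "bij_betw (\<lambda>p. h \<circ> p) {p. p permutes (A - S)} {g. g permutes A \<and> (\<forall>i\<in>S. g i = f i)}"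
  proof (rule bij_betw_byWitness[where f' = "\<lambda>g. inv h \<circ> g"])
    show "\<forall>p\<in>{p. p permutes (A - S)}. inv h \<circ> (h \<circ> p) = p"
      using permutes_inv_o(2)[OF h] by (simp add: o_assoc)
    show "\<forall>g\<in>{g. g permutes A \<and> (\<forall>i\<in>S. g i = f i)}. h \<circ> (inv h \<circ> g) = g"
      using permutes_inv_o(1)[OF h] by (simp add: o_assoc)
    show "(\<lambda>p. h \<circ> p) ` {p. p permutes (A - S)} \<subseteq> {g. g permutes A \<and> (\<forall>i\<in>S. g i = f i)}"
    proof safe
      fix p assume p: "p permutes (A - S)"
      then show "h \<circ> p permutes A"
        using h permutes_compose permutes_subset[OF p, of A] by blast
      fix i assume "i \<in> S"
      then show "(h \<circ> p) i = f i" using permutes_not_in[OF p, of i] hS by simp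
    qed
    show "(\<lambda>g. inv h \<circ> g) ` {g. g permutes A \<and> (\<forall>i\<in>S. g i = f i)} \<subseteq> {p. p permutes (A - S)}"
    proof safe
      fix g assume g: "g permutes A" "\<forall>i\<in>S. g i = f i"
      have "inv h \<circ> g permutes A" using g(1) permutes_inv[OF h] permutes_compose by blast
      \<comment> \<open>On \<open>S\<close> both \<open>g\<close> and \<open>h\<close> equal
        \<open>f\<close>, so \<open>inv h\<close> undoes \<open>g\<close> there.\<close>
      moreover have "(inv h \<circ> g) i = i" if "i \<in> S" for i
        using g(2) that hS by (simp add: permutes_inv_eq[OF h])
      ultimately show "inv h \<circ> g permutes (A - S)"
        using permutes_superset[of "inv h \<circ> g" A "A - S"] by blast
    qed
  qed
  then have "card {g. g permutes A \<and> (\<forall>i\<in>S. g i = f i)} = card {p. p permutes (A - S)}"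
    by (rule bij_betw_same_card[symmetric])
  also have "\<dots> = fact (card A - card S)"
    using assms fin by (intro card_permutations) (auto simp: card_Diff_subset)
  finally show ?thesis .
qed

definition inj_subsets :: "'a set \<Rightarrow> ('a \<Rightarrow> 'b) \<Rightarrow> nat \<Rightarrow> 'a set set" where
  "inj_subsets A f j = {S. S \<subseteq> A \<and> card S = j \<and> inj_on f S}"

lemma finite_inj_subsets: "finite A \<Longrightarrow> finite (inj_subsets A f j)"
  by (rule finite_subset[of _ "Pow A"]) (auto simp: inj_subsets_def)

lemma card_inj_subsets_le: "finite A \<Longrightarrow> card (inj_subsets A f j) \<le> card A choose j"
  by (subst n_subsets[symmetric]) (auto intro!: card_mono simp: inj_subsets_def)

text \<open>The indicator of avoiding \<open>f\<close> is the product of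
  \<open>1 - of_bool (g i = f i)\<close>; expanding it over subsets \<open>S\<close> and exchanging
  the two sums gives inclusion-exclusion.\<close>

lemma card_avoiding_permutations:
  assumes "finite A" "f ` A \<subseteq> A"
  shows "real (card {g. g permutes A \<and> (\<forall>i\<in>A. g i \<noteq> f i)}) =
    (\<Sum>j\<le>card A. (-1) ^ j * real (card (inj_subsets A f j) * fact (card A - j)))"
proof -
  define P where "P = {g. g permutes A}"
  have finP: "finite P" using assms(1) by (simp add: P_def finite_permutations)
  define E where "E S = {g. g permutes A \<and> (\<forall>i\<in>S. g i = f i)}" for S
  \<comment> \<open>A permutation cannot agree with \<open>f\<close> on a set where \<open>f\<close>
    is not injective, hence the zero.\<close>
  have cardE: "real (card (E S)) = (if inj_on f S then fact (card A - card S) else 0)" if "S \<subseteq> A" for S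
  proof (cases "inj_on f S")
    case True
    have "f ` S \<subseteq> A" using assms(2) that by blast
    then show ?thesis
      using card_permutes_extending[OF assms(1) that True] True by (simp add: E_def)
  next
    case False
    have "E S = {}"
    proof (rule ccontr)
      assume "E S \<noteq> {}"
      then obtain g where g: "g permutes A" "\<And>i. i \<in> S \<Longrightarrow> g i = f i" by (auto simp: E_def)
      have "inj_on g S" using permutes_inj[OF g(1)] by (rule inj_on_subset) simp
      then show False using False g(2) by (simp cong: inj_on_cong)
    qed
    then show ?thesis using False by simp
  qed
  have "real (card {g. g permutes A \<and> (\<forall>i\<in>A. g i \<noteq> f i)}) = (\<Sum>g\<in>P. of_bool (\<forall>i\<in>A. g i \<noteq> f i))"
    using finP by (simp add: P_def Int_def)
  also have "\<dots> = (\<Sum>g\<in>P. \<Prod>i\<in>A. 1 - of_bool (g i = f i))"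
  proof (rule sum.cong[OF refl])
    fix g
    show "of_bool (\<forall>i\<in>A. g i \<noteq> f i) = (\<Prod>i\<in>A. 1 - of_bool (g i = f i) :: real)"
      using assms(1) by (induction A rule: finite_induct) auto
  qed
  also have "\<dots> = (\<Sum>g\<in>P. \<Sum>S\<in>Pow A. (-1) ^ card S * (\<Prod>i\<in>S. of_bool (g i = f i)))"
    using assms(1) by (subst prod_diff_conv_sum) simp_all
  also have "\<dots> = (\<Sum>S\<in>Pow A. (-1) ^ card S * (\<Sum>g\<in>P. \<Prod>i\<in>S. of_bool (g i = f i)))"
    by (subst sum.swap) (simp add: sum_distrib_left)
  also have "\<dots> = (\<Sum>S\<in>Pow A. (-1) ^ card S * real (card (E S)))"
  proof (intro sum.cong refl arg_cong2[where f = "(*)"])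
    fix S assume "S \<in> Pow A"
    then have "finite S" using assms(1) finite_subset by auto
    then have "(\<Prod>i\<in>S. of_bool (g i = f i)) = (of_bool (\<forall>i\<in>S. g i = f i) :: real)" for g
      by (induction S rule: finite_induct) auto
    then show "(\<Sum>g\<in>P. \<Prod>i\<in>S. of_bool (g i = f i)) = real (card (E S))"
      using finP by (simp add: P_def E_def Int_def)
  qed
  also have "\<dots> = (\<Sum>S\<in>Pow A. if inj_on f S then (-1) ^ card S * fact (card A - card S) else 0)"
    by (intro sum.cong) (auto simp: cardE)
  \<comment> \<open>Grouping by size makes the summand constant on the injective sets of each
    group.\<close>
  also have "\<dots> = (\<Sum>j\<le>card A. \<Sum>S\<in>{S \<in> Pow A. card S = j}.
      if inj_on f S then (-1) ^ card S * fact (card A - card S) else 0)"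
    using assms(1) by (intro sum.group[symmetric]) (auto intro: card_mono)
  also have "\<dots> = (\<Sum>j\<le>card A. \<Sum>S\<in>inj_subsets A f j. (-1) ^ j * fact (card A - j))"
    using assms(1) by (intro sum.cong sum.mono_neutral_cong_right) (auto simp: inj_subsets_def)
  finally show ?thesis by (simp add: mult_ac)
qed

text \<open>Double counting of pairs \<open>(T, x)\<close> with \<open>x\<close> in \<open>T\<close>
  and \<open>T\<close> of size \<open>Suc j\<close>: each arises at most once by adding
  \<open>x\<close> to a set of size \<open>j\<close>. The truncated subtraction makes the bound
  trivial once \<open>j * k\<close> exceeds \<open>card A\<close>.\<close>

lemma card_inj_subsets_Suc_ge:
  assumes "finite A" and fibre: "\<And>y. y \<in> f ` A \<Longrightarrow> card (f -` {y} \<inter> A) \<le> k"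
  shows "card (inj_subsets A f j) * (card A - j * k) \<le> Suc j * card (inj_subsets A f (Suc j))"
proof -
  \<comment> \<open>For \<open>f\<close> injective on \<open>S\<close>, these are exactly the new
    points that keep it injective when added.\<close>
  define X where "X S = {x \<in> A. f x \<notin> f ` S}" for S
  have cardX: "card A - j * k \<le> card (X S)" if S: "S \<in> inj_subsets A f j" for S
  proof -
    have "S \<subseteq> A" "card S = j" "inj_on f S" "finite S"
      using S assms(1) finite_subset by (auto simp: inj_subsets_def)
    \<comment> \<open>The complement is covered by the fibres over the \<open>j\<close> values taken
      on \<open>S\<close>.\<close>
    have "card (A - X S) \<le> card (\<Union>y\<in>f ` S. f -` {y} \<inter> A)"
      using assms(1) \<open>finite S\<close> by (intro card_mono) (auto simp: X_def)
    also have "\<dots> \<le> (\<Sum>y\<in>f ` S. card (f -` {y} \<inter> A))"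
      using \<open>finite S\<close> by (intro card_UN_le) simp
    also have "\<dots> \<le> card (f ` S) * k"
      using fibre \<open>S \<subseteq> A\<close> sum_bounded_above[of "f ` S" "\<lambda>y. card (f -` {y} \<inter> A)" k] by auto
    finally have "card (A - X S) \<le> j * k"
      using \<open>inj_on f S\<close> \<open>card S = j\<close> by (simp add: card_image)
    moreover have "card (A - X S) = card A - card (X S)"
      using assms(1) by (intro card_Diff_subset) (auto simp: X_def)
    ultimately show ?thesis by linarith
  qed
  have finX: "finite (X S)" for S using assms(1) by (simp add: X_def)
  have fins: "finite T" if "T \<in> inj_subsets A f i" for T i
    using that assms(1) finite_subset by (auto simp: inj_subsets_def)
  have "card (inj_subsets A f j) * (card A - j * k) \<le> (\<Sum>S\<in>inj_subsets A f j. card (X S))"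
    using sum_bounded_below[of "inj_subsets A f j" "card A - j * k" "\<lambda>S. card (X S)"] cardX by simp
  also have "\<dots> = card (SIGMA S:inj_subsets A f j. X S)"
    by (rule card_SigmaI[symmetric]) (use finite_inj_subsets[OF assms(1)] finX in auto)
  also have "\<dots> \<le> card (SIGMA T:inj_subsets A f (Suc j). T)"
  proof (rule card_inj_on_le[where f = "\<lambda>(S, x). (insert x S, x)"])
    \<comment> \<open>Since \<open>x\<close> lies outside \<open>S\<close>, deleting it from
      \<open>insert x S\<close> recovers \<open>S\<close>.\<close>
    show "inj_on (\<lambda>(S, x). (insert x S, x)) (SIGMA S:inj_subsets A f j. X S)"
      by (rule inj_on_inverseI[where g = "\<lambda>(T, x). (T - {x}, x)"]) (auto simp: X_def)
    show "(\<lambda>(S, x). (insert x S, x)) ` (SIGMA S:inj_subsets A f j. X S)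
        \<subseteq> (SIGMA T:inj_subsets A f (Suc j). T)"
    proof clarsimp
      fix S x assume S: "S \<in> inj_subsets A f j" and x: "x \<in> X S"
      then have "x \<notin> S" by (auto simp: X_def)
      then show "insert x S \<in> inj_subsets A f (Suc j)"
        using S x fins[OF S] by (auto simp: X_def inj_subsets_def)
    qed
    show "finite (SIGMA T:inj_subsets A f (Suc j). T)"
      by (rule finite_SigmaI) (use finite_inj_subsets[OF assms(1)] fins in auto)
  qed
  also have "\<dots> = (\<Sum>T\<in>inj_subsets A f (Suc j). card T)"
    by (rule card_SigmaI) (use finite_inj_subsets[OF assms(1)] fins in auto)
  also have "\<dots> = Suc j * card (inj_subsets A f (Suc j))"
    by (simp add: inj_subsets_def)
  finally show ?thesis .
qed

theorem theorem1:
  fixes k :: nat and f :: "nat \<Rightarrow> nat \<Rightarrow> nat"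
  assumes "k \<ge> 1"
    and "\<And>n. n \<ge> 1 \<Longrightarrow> f n \<in> {1..n} \<rightarrow> {1..n}"
    and "\<And>n. n \<ge> 1 \<Longrightarrow> k_max k n (f n)"
  shows "(\<lambda>n. real (num_f_derangements n (f n)) / fact n) \<longlonglongrightarrow> 1 / exp 1"
proof -
  define N where "N j n = card (inj_subsets {1..n} (f n) j)" for j n
  \<comment> \<open>This is the absolute value of the \<open>j\<close>-th inclusion-exclusion term,
    divided by \<open>fact n\<close>.\<close>
  define p where "p j n = real (N j n) * fact (n - j) / fact n" for j n
  have maps: "f n ` {1..n} \<subseteq> {1..n}" for n
    using assms(2)[of n] by (cases "n = 0") auto
  have N_upper: "N j n \<le> n choose j" for j n
    using card_inj_subsets_le[of "{1..n}" "f n" j] by (simp add: N_def)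
  have p_nonneg: "p j n \<ge> 0" for j n by (simp add: p_def)
  have p_upper: "p j n \<le> 1 / fact j" for j n
  proof (cases "j \<le> n")
    case True
    have "p j n \<le> real (n choose j) * fact (n - j) / fact n"
      unfolding p_def using N_upper[of j n] by (intro divide_right_mono mult_right_mono) auto
    also have "\<dots> = 1 / fact j" using True by (simp add: binomial_fact)
    finally show ?thesis .
  next
    case False
    \<comment> \<open>Here \<open>fact (n - j)\<close> is 1 by truncation; the term vanishes because
      \<open>N j n\<close> does.\<close>
    then show ?thesis using N_upper[of j n] by (simp add: p_def binomial_eq_0)
  qed
  \<comment> \<open>The counting inequality becomes a recursion for \<open>p\<close>; the
    denominator \<open>n - j\<close> comes from the ratio of \<open>fact (n - j)\<close> to
    \<open>fact (n - Suc j)\<close>.\<close>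
  have p_lower: "p j n * ((real n - real (j * k)) / (real n - real j)) / real (Suc j) \<le> p (Suc j) n"
    if "n > j" for j n
  proof -
    have "card (f n -` {y} \<inter> {1..n}) \<le> k" if "y \<in> f n ` {1..n}" for y
      using assms(3)[of n] maps[of n] that \<open>n > j\<close> by (auto simp: k_max_def)
    from card_inj_subsets_Suc_ge[of "{1..n}", OF _ this]
    have "N j n * (n - j * k) \<le> Suc j * N (Suc j) n" by (simp add: N_def)
    then have "real (N j n) * real (n - j * k) \<le> real (Suc j) * real (N (Suc j) n)"
      by (simp only: of_nat_mult[symmetric] of_nat_le_iff)
    \<comment> \<open>The real difference may be negative, where the truncated one is 0.\<close>
    moreover have "real (N j n) * (real n - real (j * k)) \<le> real (N j n) * real (n - j * k)"
      by (intro mult_left_mono) (auto simp del: of_nat_mult)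
    ultimately have le: "real (N j n) * (real n - real (j * k)) / real (Suc j) \<le> real (N (Suc j) n)"
      by (simp add: field_simps del: of_nat_mult of_nat_Suc)
    have "n - j = Suc (n - Suc j)" using that by simp
    then have fact_eq: "fact (n - j) = (real n - real j) * (fact (n - Suc j) :: real)"
      using that by (simp add: of_nat_diff)
    have cancel: "a * (d * b) / q * (m / d) / s = a * m / s * b / q" if "d \<noteq> 0"
      for a b d m q s :: real
      using that by (simp add: mult_ac)
    have "p j n * ((real n - real (j * k)) / (real n - real j)) / real (Suc j)
        = real (N j n) * (real n - real (j * k)) / real (Suc j) * fact (n - Suc j) / fact n"
      unfolding p_def fact_eq by (rule cancel) (use that in simp)
    also have "\<dots> \<le> real (N (Suc j) n) * fact (n - Suc j) / fact n"
      using le by (intro divide_right_mono mult_right_mono) auto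
    finally show ?thesis by (simp add: p_def)
  qed
  have p_lim: "(\<lambda>n. p j n) \<longlonglongrightarrow> 1 / fact j" for j
  proof (induction j)
    case 0
    \<comment> \<open>Infinite sets also have \<open>card\<close> 0, but subsets of
      \<open>{1..n}\<close> are finite.\<close>
    have "inj_subsets {1..n} (f n) 0 = {{}}" for n
      by (auto simp: inj_subsets_def dest: finite_subset)
    then show ?case by (simp add: p_def N_def)
  next
    case (Suc j)
    \<comment> \<open>Both \<open>j\<close> and \<open>k\<close> stay fixed as \<open>n\<close>
      grows, so the correction factor disappears in the limit.\<close>
    have "(\<lambda>n. (real n - real (j * k)) / (real n - real j)) \<longlonglongrightarrow> 1"
      by real_asymp
    from tendsto_divide[OF tendsto_mult[OF Suc.IH this] tendsto_const[of "real (Suc j)"]]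
    have low: "(\<lambda>n. p j n * ((real n - real (j * k)) / (real n - real j)) / real (Suc j))
        \<longlonglongrightarrow> 1 / fact (Suc j)"
      by (simp add: mult.commute)
    show ?case
    proof (rule tendsto_sandwich[OF _ _ low tendsto_const])
      show "\<forall>\<^sub>F n in sequentially.
          p j n * ((real n - real (j * k)) / (real n - real j)) / real (Suc j) \<le> p (Suc j) n"
        using eventually_gt_at_top[of j] by eventually_elim (rule p_lower)
      show "\<forall>\<^sub>F n in sequentially. p (Suc j) n \<le> 1 / fact (Suc j)"
        using p_upper by (intro always_eventually allI)
    qed
  qed
  \<comment> \<open>Terms with \<open>j > n\<close> vanish, so the finite sum is a series whose
    index range no longer depends on \<open>n\<close>, as Tannery's theorem needs.\<close>
  have formula: "real (num_f_derangements n (f n)) / fact n = (\<Sum>j. (-1) ^ j * p j n)" for n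
  proof -
    have "real (num_f_derangements n (f n)) =
        (\<Sum>j\<le>n. (-1) ^ j * real (N j n * fact (n - j)))"
      using card_avoiding_permutations[of "{1..n}", OF _ maps]
      by (simp add: num_f_derangements_def f_derangement_def N_def)
    then have "real (num_f_derangements n (f n)) / fact n = (\<Sum>j\<le>n. (-1) ^ j * p j n)"
      by (simp add: p_def sum_divide_distrib)
    also have "\<dots> = (\<Sum>j. (-1) ^ j * p j n)"
    proof (rule suminf_finite[symmetric])
      show "(-1) ^ j * p j n = 0" if "j \<notin> {..n}" for j
        using N_upper[of j n] that by (simp add: p_def binomial_eq_0)
    qed simp
    finally show ?thesis .
  qed
  have "(\<lambda>n. \<Sum>j. (-1) ^ j * p j n) \<longlonglongrightarrow> (\<Sum>j. (-1) ^ j * (1 / fact j))"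
  proof (rule tannerys_theorem[THEN conjunct2, THEN conjunct2])
    show "(\<lambda>n. (-1) ^ j * p j n) \<longlonglongrightarrow> (-1) ^ j * (1 / fact j)" for j
      using p_lim by (intro tendsto_intros)
    \<comment> \<open>The bound \<open>p_upper\<close> is uniform in \<open>n\<close> and supplies
      the dominating series.\<close>
    show "\<forall>\<^sub>F (j, n) in sequentially \<times>\<^sub>F sequentially. norm ((-1) ^ j * p j n) \<le> 1 / fact j"
      using p_upper p_nonneg by (intro always_eventually) (auto simp: abs_mult power_abs)
    show "summable (\<lambda>j. 1 / fact j :: real)"
      using summable_exp[of "1::real"] by (simp add: field_simps)
  qed simp
  \<comment> \<open>This is the exponential series at -1.\<close>
  moreover have "(\<Sum>j. (-1) ^ j * (1 / fact j)) = 1 / exp (1::real)"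
    using sums_unique[OF exp_converges[of "-1::real"]] by (simp add: exp_minus field_simps)
  ultimately show ?thesis by (simp add: formula)
qed

end
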